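(* Assume the Continuum Hypothesis. Then there is a matroid $M$ on a countable ground set $E$ such that the family $(M,M)$ consisting of two copies of $M$ admits a base packing and a base covering, but does not admit a base partitioning.
   Context: Matroids here are possibly infinite: a matroid is a pair $(E,\mathcal{I})$ with $\mathcal{I}\subseteq\mathcal{P}(E)$ such that (1) $\emptyset\in\mathcal{I}$; (2) $\mathcal{I}$ is closed under subsets; (3) for all $I,B\in\mathcal{I}$ with $B$ maximal in $\mathcal{I}$ and $I$ not maximal, there is $x\in B\setminus I$ with $I\cup\{x\}\in\mathcal{I}$; (4) for every $X\subseteq E$, every $I\in\mathcal{I}$ with $I\subseteq X$ extends to a maximal element of $\mathcal{I}\cap\mathcal{P}(X)$. Bases are maximal independent sets. For a family $(M_i\colon i\in K)$ of matroids on $E$, a family $(B_i\colon i\in K)$ with each $B_i$ a base of $M_i$ is a base covering if $\bigcup_i B_i=E$, a base packing if the $B_i$ are pairwise disjoint, and a base partitioning if it is a partition of $E$. *)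

theory Defs
  imports Complex_Main "HOL-Library.Countable_Set" "HOL-Library.Equipollence"
begin

definition CH :: bool where
  "CH \<longleftrightarrow> (\<forall>A :: real set. countable A \<or> A \<approx> (UNIV :: real set))"

definition maximal_in :: "'a set set \<Rightarrow> 'a set \<Rightarrow> bool" where
  "maximal_in F B \<longleftrightarrow> B \<in> F \<and> (\<forall>C\<in>F. B \<subseteq> C \<longrightarrow> C = B)"

text \<open>Possibly infinite matroid (E, I) given by independence axioms (I1)-(I3), (IM).\<close>
definition matroid :: "'a set \<Rightarrow> 'a set set \<Rightarrow> bool" where
  "matroid E Ind \<longleftrightarrow>
     Ind \<subseteq> Pow E \<and>
     {} \<in> Ind \<and>
     (\<forall>I\<in>Ind. \<forall>J. J \<subseteq> I \<longrightarrow> J \<in> Ind) \<and>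
     (\<forall>I\<in>Ind. \<forall>B. maximal_in Ind B \<and> \<not> maximal_in Ind I \<longrightarrow>
        (\<exists>x\<in>B - I. insert x I \<in> Ind)) \<and>
     (\<forall>X. X \<subseteq> E \<longrightarrow> (\<forall>I\<in>Ind. I \<subseteq> X \<longrightarrow>
        (\<exists>B. I \<subseteq> B \<and> maximal_in (Ind \<inter> Pow X) B)))"

definition base :: "'a set set \<Rightarrow> 'a set \<Rightarrow> bool" where
  "base Ind B \<longleftrightarrow> maximal_in Ind B"

text \<open>For the family (M, M) of two copies of a matroid M = (E, Ind).\<close>
definition has_base_packing2 :: "'a set \<Rightarrow> 'a set set \<Rightarrow> bool" where
  "has_base_packing2 E Ind \<longleftrightarrow> (\<exists>B1 B2. base Ind B1 \<and> base Ind B2 \<and> B1 \<inter> B2 = {})"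

definition has_base_covering2 :: "'a set \<Rightarrow> 'a set set \<Rightarrow> bool" where
  "has_base_covering2 E Ind \<longleftrightarrow> (\<exists>B1 B2. base Ind B1 \<and> base Ind B2 \<and> B1 \<union> B2 = E)"

definition has_base_partitioning2 :: "'a set \<Rightarrow> 'a set set \<Rightarrow> bool" where
  "has_base_partitioning2 E Ind \<longleftrightarrow>
     (\<exists>B1 B2. base Ind B1 \<and> base Ind B2 \<and> B1 \<inter> B2 = {} \<and> B1 \<union> B2 = E)"

end

theory Submission
  imports Defs "HOL-Analysis.Abstract_Topology_2"
begin

text \<open>
  Call \<open>M\<close> uniform if replacing an element of a base by any element outside it gives a base again.
  A uniform matroid on \<open>\<nat>\<close> is given by an antichain \<open>U\<close> closed under such replacements which, for
  all \<open>A \<subseteq> X\<close> with \<open>X - A\<close> infinite, has a member above \<open>X\<close>, below \<open>A\<close>, or between \<open>A\<close> and \<open>X\<close>;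
  for finite \<open>X - A\<close> the last matroid axiom is automatic. Under the Continuum Hypothesis the pairs
  \<open>(A, X)\<close> can be listed so that every initial segment is countable, and they are treated one after
  the other. If no base of the countable family built so far settles \<open>(A, X)\<close>, every base \<open>B\<close> leaves
  \<open>X - B\<close> and \<open>B - A\<close> infinite. A set \<open>D\<close> that splits every infinite trace of a base or of its
  complement on \<open>X - A\<close> then yields a new base \<open>A \<union> (D \<inter> (X - A))\<close> which is, even modulo finite sets,
  incomparable to the old ones and not the complement of one. So no two bases ever become
  complementary, while a packing and a covering are put into the initial family.
\<close>

section \<open>Finite exchange classes and base families\<close>

text \<open>This is the least family that contains \<open>C\<close> and is closed under replacing
  one element by another.\<close>

definition finite_swaps :: "'a set \<Rightarrow> 'a set set" where
  "finite_swaps C = {C'. finite (C - C') \<and> finite (C' - C) \<and> card (C - C') = card (C' - C)}"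

definition base_family :: "'a set set \<Rightarrow> bool" where
  "base_family U \<longleftrightarrow>
     (\<forall>B\<in>U. \<forall>C\<in>U. B \<subseteq> C \<longrightarrow> B = C) \<and>
     (\<forall>B\<in>U. \<forall>z\<in>B. \<forall>x. x \<notin> B \<longrightarrow> insert x (B - {z}) \<in> U) \<and>
     (\<forall>B\<in>U. - B \<notin> U)"

text \<open>The pair \<open>p\<close> is \<open>(A, X)\<close>. The premises make the claim vacuous
  for pairs that are not nested or have a finite gap, so a recursion can simply run over all
  pairs.\<close>

definition settles :: "'a set \<times> 'a set \<Rightarrow> 'a set set \<Rightarrow> bool" where
  "settles p U \<longleftrightarrow> (fst p \<subseteq> snd p \<longrightarrow> infinite (snd p - fst p) \<longrightarrow>
     (\<exists>B\<in>U. snd p \<subseteq> B \<or> B \<subseteq> fst p \<or> (fst p \<subseteq> B \<and> B \<subseteq> snd p)))"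

lemma base_family_antichain: "base_family U \<Longrightarrow> B \<in> U \<Longrightarrow> C \<in> U \<Longrightarrow> B \<subseteq> C \<Longrightarrow> B = C"
  by (simp add: base_family_def)

lemma base_family_swap:
  "base_family U \<Longrightarrow> B \<in> U \<Longrightarrow> z \<in> B \<Longrightarrow> x \<notin> B \<Longrightarrow> insert x (B - {z}) \<in> U"
  by (simp add: base_family_def)

lemma base_family_compl: "base_family U \<Longrightarrow> B \<in> U \<Longrightarrow> - B \<notin> U"
  by (simp add: base_family_def)

lemma base_family_swap_finite:
  assumes U: "base_family U" and "finite F" "finite G" "card F = card G"
    "B \<in> U" "F \<subseteq> B" "G \<inter> B = {}"
  shows "(B - F) \<union> G \<in> U"
  using assms(2-)
proof (induction F arbitrary: G B rule: finite_induct)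
  case empty
  then show ?case by simp
next
  case (insert z F)
  then obtain x G' where G: "G = insert x G'" "x \<notin> G'" "card F = card G'" "finite G'"
    by (metis card_Suc_eq card_insert_disjoint finite_insert)
  let ?B = "insert x (B - {z})"
  have "?B \<in> U"
    using base_family_swap[OF U, of B z x] insert.prems G by auto
  moreover have "F \<subseteq> ?B" "G' \<inter> ?B = {}"
    using insert.prems insert.hyps G by auto
  ultimately have "(?B - F) \<union> G' \<in> U"
    using insert.IH G by blast
  moreover have "(?B - F) \<union> G' = (B - insert z F) \<union> G"
    using insert.prems insert.hyps G by auto
  ultimately show ?case by simp
qed

lemma finite_swaps_refl: "C \<in> finite_swaps C"
  by (simp add: finite_swaps_def)

text \<open>Passing from \<open>B\<close> to a larger \<open>B'\<close> can only shrink the part of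
  \<open>C\<close> left out and enlarge the part outside \<open>C\<close>. Both parts have the same
  finite size for each set, so neither changes.\<close>

lemma finite_swaps_antichain:
  assumes "B \<in> finite_swaps C" "B' \<in> finite_swaps C" "B \<subseteq> B'"
  shows "B = B'"
proof -
  have fin: "finite (C - B)" "finite (B - C)" "finite (C - B')" "finite (B' - C)"
    and card: "card (C - B) = card (B - C)" "card (C - B') = card (B' - C)"
    using assms by (auto simp: finite_swaps_def)
  have sub: "C - B' \<subseteq> C - B" "B - C \<subseteq> B' - C"
    using assms by auto
  have "card (C - B') \<le> card (C - B)" "card (B - C) \<le> card (B' - C)"
    using sub fin by (auto intro: card_mono)
  then have "card (C - B') = card (C - B)" "card (B - C) = card (B' - C)"
    using card by auto
  then have "C - B' = C - B" "B - C = B' - C"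
    using sub fin by (simp_all add: card_subset_eq)
  then show ?thesis by blast
qed

text \<open>Dropping \<open>z\<close> raises the excess of \<open>card (C - B)\<close> over
  \<open>card (B - C)\<close> by one and adding \<open>x\<close> lowers it by one. The four cases
  tell in which difference each change happens.\<close>

lemma finite_swaps_swap:
  assumes "B \<in> finite_swaps C" "z \<in> B" "x \<notin> B"
  shows "insert x (B - {z}) \<in> finite_swaps C"
proof -
  let ?B = "insert x (B - {z})"
  have fin: "finite (C - B)" "finite (B - C)" and card: "card (C - B) = card (B - C)"
    using assms by (auto simp: finite_swaps_def)
  have 1: "C - ?B = (if z \<in> C then insert z (C - B - {x}) else C - B - {x})"
    using assms by auto
  have 2: "?B - C = (if x \<in> C then B - C - {z} else insert x (B - C - {z}))"
    using assms by auto
  have "card (C - ?B) = card (?B - C)"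
  proof (cases "z \<in> C"; cases "x \<in> C")
    assume zx: "z \<in> C" "x \<in> C"
    then have "card (C - ?B) = Suc (card (C - B - {x}))" unfolding 1 using fin assms by simp
    also have "\<dots> = card (C - B)" using fin assms zx by (intro card.remove[symmetric]) auto
    also have "B - C = ?B - C" unfolding 2 using zx by auto
    then have "card (C - B) = card (?B - C)" using card by simp
    finally show ?thesis .
  next
    assume zx: "z \<in> C" "x \<notin> C"
    then have "C - B - {x} = C - B" "B - C - {z} = B - C" by auto
    then show ?thesis unfolding 1 2 using zx fin assms card by simp
  next
    assume zx: "z \<notin> C" "x \<in> C"
    then have "card (C - B) = Suc (card (C - B - {x}))" "card (B - C) = Suc (card (B - C - {z}))"
      using fin assms zx by (blast intro: card.remove)+
    then show ?thesis unfolding 1 2 using zx card by simp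
  next
    assume zx: "z \<notin> C" "x \<notin> C"
    then have "card (?B - C) = Suc (card (B - C - {z}))" unfolding 2 using fin assms by simp
    also have "\<dots> = card (B - C)" using fin assms zx by (intro card.remove[symmetric]) auto
    also have "C - B = C - ?B" unfolding 1 using zx by auto
    then have "card (B - C) = card (C - ?B)" using card by simp
    finally show ?thesis by simp
  qed
  moreover have "finite (C - ?B)" "finite (?B - C)"
    unfolding 1 2 using fin by auto
  ultimately show ?thesis by (simp add: finite_swaps_def)
qed

lemma countable_finite_swaps:
  fixes C :: "'a::countable set"
  shows "countable (finite_swaps C)"
proof -
  let ?F = "{F :: 'a set. finite F}"
  have "finite_swaps C \<subseteq> (\<lambda>(F, G). (C - F) \<union> G) ` (?F \<times> ?F)"
  proof
    fix C' assume "C' \<in> finite_swaps C"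
    then have "(C - C', C' - C) \<in> ?F \<times> ?F" by (simp add: finite_swaps_def)
    moreover have "C' = (\<lambda>(F, G). (C - F) \<union> G) (C - C', C' - C)" by auto
    ultimately show "C' \<in> (\<lambda>(F, G). (C - F) \<union> G) ` (?F \<times> ?F)" by (rule rev_image_eqI)
  qed
  moreover have "countable ?F"
    by (rule countable_Collect_finite)
  ultimately show ?thesis
    by (meson countable_SIGMA countable_image countable_subset)
qed

text \<open>Infinite differences survive finite changes, so new and old sets are incomparable. A
  finite swap leading from \<open>C'\<close> to \<open>C\<close> is also one between their
  complements, so \<open>- C' \<in> U\<close> would give \<open>- C \<in> U\<close>. Finally, two
  complementary sets cannot both differ finitely from \<open>C\<close> on an infinite ground
  set.\<close>

lemma base_family_add:
  fixes C :: "'a set"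
  assumes inf: "infinite (UNIV :: 'a set)" and U: "base_family U"
    and C: "\<And>B. B \<in> U \<Longrightarrow> infinite (C - B)" "\<And>B. B \<in> U \<Longrightarrow> infinite (B - C)" "- C \<notin> U"
  shows "base_family (U \<union> finite_swaps C)"
proof -
  have not_le: "\<not> C' \<subseteq> B" "\<not> B \<subseteq> C'" if "C' \<in> finite_swaps C" "B \<in> U" for C' B
  proof -
    have "C' \<subseteq> B \<Longrightarrow> C - B \<subseteq> C - C'" "B \<subseteq> C' \<Longrightarrow> B - C \<subseteq> C' - C"
      by auto
    then show "\<not> C' \<subseteq> B" "\<not> B \<subseteq> C'"
      using C(1,2)[OF that(2)] that(1) finite_subset unfolding finite_swaps_def by auto
  qed
  have compl: "- C' \<notin> U" if "C' \<in> finite_swaps C" for C'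
  proof
    assume "- C' \<in> U"
    then have "(- C' - (C - C')) \<union> (C' - C) \<in> U"
      using base_family_swap_finite[OF U, of "C - C'" "C' - C" "- C'"] that
      by (auto simp: finite_swaps_def)
    moreover have "(- C' - (C - C')) \<union> (C' - C) = - C"
      by blast
    ultimately show False using C(3) by simp
  qed
  have compl': "- C' \<notin> finite_swaps C" if "C' \<in> finite_swaps C" for C'
  proof
    assume "- C' \<in> finite_swaps C"
    then have "finite ((C - C') \<union> (C' - C) \<union> (C - - C') \<union> (- C' - C))"
      using that by (simp add: finite_swaps_def)
    moreover have "(C - C') \<union> (C' - C) \<union> (C - - C') \<union> (- C' - C) = UNIV"
      by blast
    ultimately show False using inf by metis
  qed
  show ?thesis
    unfolding base_family_def
  proof (intro conjI ballI allI impI)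
    fix B B' assume "B \<in> U \<union> finite_swaps C" "B' \<in> U \<union> finite_swaps C" "B \<subseteq> B'"
    then consider "B \<in> U" "B' \<in> U" | "B \<in> finite_swaps C" "B' \<in> finite_swaps C"
      using not_le by blast
    then show "B = B'"
      by cases (use \<open>B \<subseteq> B'\<close> base_family_antichain[OF U] finite_swaps_antichain in blast)+
  next
    fix B z x assume "B \<in> U \<union> finite_swaps C" "z \<in> B" "x \<notin> B"
    then show "insert x (B - {z}) \<in> U \<union> finite_swaps C"
      using base_family_swap[OF U, of B z x] finite_swaps_swap[of B C z x] by blast
  next
    fix B assume "B \<in> U \<union> finite_swaps C"
    then consider "B \<in> U" | "B \<in> finite_swaps C" by blast
    then show "- B \<notin> U \<union> finite_swaps C"
    proof cases
      case 1
      then show ?thesis using base_family_compl[OF U 1] compl[of "- B"] by auto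
    next
      case 2
      then show ?thesis using compl[OF 2] compl'[OF 2] by simp
    qed
  qed
qed

text \<open>Each clause concerns at most two given members, and any two lie in a common family of
  the chain.\<close>

lemma base_family_Union_chain:
  assumes "\<And>U. U \<in> \<C> \<Longrightarrow> base_family U" "\<And>U V. U \<in> \<C> \<Longrightarrow> V \<in> \<C> \<Longrightarrow> U \<subseteq> V \<or> V \<subseteq> U"
  shows "base_family (\<Union>\<C>)"
proof -
  have common: "\<exists>U\<in>\<C>. B \<in> U \<and> B' \<in> U" if BB': "B \<in> \<Union>\<C>" "B' \<in> \<Union>\<C>" for B B'
  proof -
    obtain U V where "U \<in> \<C>" "B \<in> U" "V \<in> \<C>" "B' \<in> V" using BB' by blast
    then show ?thesis using assms(2)[of U V] by blast
  qed
  show ?thesis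
    unfolding base_family_def
  proof (intro conjI ballI allI impI)
    fix B B' assume *: "B \<in> \<Union>\<C>" "B' \<in> \<Union>\<C>" "B \<subseteq> B'"
    obtain U where "U \<in> \<C>" "B \<in> U" "B' \<in> U" using common[OF *(1,2)] by blast
    then show "B = B'" using base_family_antichain[of U B B'] assms(1) *(3) by blast
  next
    fix B z x assume *: "B \<in> \<Union>\<C>" "z \<in> B" "x \<notin> B"
    then obtain U where "U \<in> \<C>" "B \<in> U" by blast
    then show "insert x (B - {z}) \<in> \<Union>\<C>" using base_family_swap[of U B z x] assms(1) * by blast
  next
    fix B assume *: "B \<in> \<Union>\<C>"
    show "- B \<notin> \<Union>\<C>"
    proof
      assume "- B \<in> \<Union>\<C>"
      then obtain U where "U \<in> \<C>" "B \<in> U" "- B \<in> U" using common[OF *] by blast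
      then show False using base_family_compl[of U B] assms(1) by blast
    qed
  qed
qed

section \<open>Splitting countably many infinite sets\<close>

lemma splitting_set_exists:
  fixes \<A> :: "nat set set"
  assumes "countable \<A>" "\<And>S. S \<in> \<A> \<Longrightarrow> infinite S"
  obtains D where "\<And>S. S \<in> \<A> \<Longrightarrow> infinite (S \<inter> D) \<and> infinite (S - D)"
proof (cases "\<A> = {}")
  case True
  then show ?thesis using that by blast
next
  case False
  then obtain e :: "nat \<Rightarrow> nat set" where e: "\<A> = range e"
    using assms(1) uncountable_def by metis
  \<comment> \<open>If \<open>n\<close> codes \<open>(i, k)\<close>, then \<open>g n\<close> is a
    point picked from \<open>e i\<close> with label \<open>k\<close>. Every \<open>e i\<close> is
    thus visited infinitely often, and strict increase keeps all picks distinct.\<close>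
  have "\<exists>g. \<forall>n. g n \<in> e (fst (prod_decode n)) \<and> g n < g (Suc n)"
    using assms(2) unfolding e
    by (intro dependent_nat_choice) (auto simp: infinite_nat_iff_unbounded dest: infinite_imp_nonempty)
  then obtain g :: "nat \<Rightarrow> nat"
    where g: "\<And>n. g n \<in> e (fst (prod_decode n))" "\<And>n. g n < g (Suc n)"
    by blast
  have inj: "inj g"
    using g(2) by (simp add: strict_mono_Suc_iff strict_mono_imp_inj_on)
  \<comment> \<open>Picks with even label go into \<open>D\<close>. By injectivity a pick with odd
    label cannot enter \<open>D\<close> through another index, so each \<open>e i\<close> has
    infinitely many points on both sides.\<close>
  define D where "D = {g n | n. even (snd (prod_decode n))}"
  have inD: "g (prod_encode (i, k)) \<in> D \<longleftrightarrow> even k" for i k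
    unfolding D_def by (auto simp: inj_eq[OF inj] intro!: exI[of _ "prod_encode (i, k)"])
  have inS: "g (prod_encode (i, k)) \<in> e i" for i k
    using g(1)[of "prod_encode (i, k)"] by simp
  have "infinite (e i \<inter> D)" "infinite (e i - D)" for i
  proof -
    have "inj (\<lambda>k. g (prod_encode (i, 2 * k)))" "inj (\<lambda>k. g (prod_encode (i, 2 * k + 1)))"
      by (auto simp: inj_def inj_eq[OF inj])
    moreover have "range (\<lambda>k. g (prod_encode (i, 2 * k))) \<subseteq> e i \<inter> D"
      "range (\<lambda>k. g (prod_encode (i, 2 * k + 1))) \<subseteq> e i - D"
      using inD inS by auto
    ultimately show "infinite (e i \<inter> D)" "infinite (e i - D)"
      by (blast dest: range_inj_infinite infinite_super)+
  qed
  then show ?thesis using that e by blast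
qed

section \<open>Settling a single pair\<close>

text \<open>Finitely many swaps repair \<open>B\<close>: the missing points \<open>X - B\<close>
  come in, paid for by points outside \<open>X\<close> as long as these suffice, and by points of
  \<open>X - A\<close> after that.\<close>

lemma finite_settles_above:
  assumes U: "base_family U" and B: "B \<in> U" and X: "A \<subseteq> X" "infinite (X - A)"
    and fin: "finite (X - B)"
  shows "\<exists>B\<in>U. X \<subseteq> B \<or> (A \<subseteq> B \<and> B \<subseteq> X)"
proof (cases "\<exists>F \<subseteq> B - X. finite F \<and> card F = card (X - B)")
  case True
  then obtain F where F: "F \<subseteq> B - X" "finite F" "card F = card (X - B)"
    by blast
  then have "(B - F) \<union> (X - B) \<in> U"
    using fin B by (intro base_family_swap_finite[OF U]) auto
  moreover have "X \<subseteq> (B - F) \<union> (X - B)"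
    using F by auto
  ultimately show ?thesis by blast
next
  case False
  \<comment> \<open>With too few points outside \<open>X\<close>, all of \<open>B - X\<close> leaves
    and the shortfall is taken from \<open>X \<inter> B - A\<close>. The result lies inside
    \<open>X\<close> and still contains \<open>A\<close>.\<close>
  then have finB: "finite (B - X)" and "card (B - X) < card (X - B)"
    by (meson infinite_arbitrarily_large, meson obtain_subset_with_card_n not_less)
  have "X - A = (X \<inter> B - A) \<union> (X - B - A)" by blast
  then have "infinite (X \<inter> B - A)"
    using X(2) fin by (metis finite_Diff finite_Un)
  then obtain F where F: "F \<subseteq> X \<inter> B - A" "finite F" "card F = card (X - B) - card (B - X)"
    using infinite_arbitrarily_large by metis
  have "(B - ((B - X) \<union> F)) \<union> (X - B) \<in> U"
  proof (rule base_family_swap_finite[OF U])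
    have "card ((B - X) \<union> F) = card (B - X) + card F"
      using F finB by (intro card_Un_disjoint) auto
    then show "card ((B - X) \<union> F) = card (X - B)"
      using F \<open>card (B - X) < card (X - B)\<close> by simp
  qed (use F finB fin B in auto)
  moreover have "A \<subseteq> (B - ((B - X) \<union> F)) \<union> (X - B)" "(B - ((B - X) \<union> F)) \<union> (X - B) \<subseteq> X"
    using F X by auto
  ultimately show ?thesis by blast
qed

text \<open>Duality: putting \<open>x\<close> for \<open>z\<close> in a set is putting
  \<open>z\<close> for \<open>x\<close> in its complement.\<close>

lemma base_family_dual: "base_family U \<Longrightarrow> base_family (uminus ` U)"
  unfolding base_family_def
proof (intro conjI ballI allI impI; elim conjE)
  fix B z x
  assume swap: "\<forall>B\<in>U. \<forall>z\<in>B. \<forall>x. x \<notin> B \<longrightarrow> insert x (B - {z}) \<in> U"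
    and B: "B \<in> uminus ` U" "z \<in> B" "x \<notin> B"
  then have "insert z (- B - {x}) \<in> U" by auto
  moreover have "insert x (B - {z}) = - insert z (- B - {x})" using B by auto
  ultimately show "insert x (B - {z}) \<in> uminus ` U" by blast
qed auto

lemma finite_settles_below:
  assumes U: "base_family U" and B: "B \<in> U" and X: "A \<subseteq> X" "infinite (X - A)"
    and fin: "finite (B - A)"
  shows "\<exists>B\<in>U. B \<subseteq> A \<or> (A \<subseteq> B \<and> B \<subseteq> X)"
proof -
  \<comment> \<open>The dual of the pair \<open>(A, X)\<close> is \<open>(- X, - A)\<close>, which
    has the same gap \<open>X - A\<close>.\<close>
  have "\<exists>B\<in>uminus ` U. - A \<subseteq> B \<or> (- X \<subseteq> B \<and> B \<subseteq> - A)"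
  proof (rule finite_settles_above[OF base_family_dual[OF U]])
    show "- B \<in> uminus ` U" using B by blast
    show "- X \<subseteq> - A" using X by blast
    have "- A - - X = X - A" "- A - - B = B - A" by auto
    then show "infinite (- A - - X)" "finite (- A - - B)" using X fin by auto
  qed
  then show ?thesis by auto
qed

lemma base_family_extend:
  fixes U :: "nat set set"
  assumes U: "base_family U" and "countable U"
  shows "\<exists>V. U \<subseteq> V \<and> base_family V \<and> countable V \<and> settles p V"
proof (cases "settles p U")
  case True
  then show ?thesis using assms by blast
next
  case False
  define A X where "A = fst p" and "X = snd p"
  have X: "A \<subseteq> X" "infinite (X - A)"
    and no: "\<not> (\<exists>B\<in>U. X \<subseteq> B \<or> B \<subseteq> A \<or> (A \<subseteq> B \<and> B \<subseteq> X))"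
    using False unfolding settles_def A_def X_def by auto
  define Y where "Y = X - A"
  \<comment> \<open>A base that contains \<open>X\<close>, or is contained in \<open>A\<close>, up
    to finitely many points could be repaired by swaps so as to settle the pair, which
    \<open>no\<close> excludes.\<close>
  have inf: "infinite (X - B)" "infinite (B - A)" if "B \<in> U" for B
    using finite_settles_above[OF U that X] finite_settles_below[OF U that X] no by blast+
  let ?\<A> = "{S \<in> (\<lambda>B. Y \<inter> B) ` U \<union> (\<lambda>B. Y - B) ` U. infinite S}"
  have "countable ?\<A>"
    using \<open>countable U\<close> by (intro countable_subset[OF Collect_restrict]) auto
  then obtain D where D: "\<And>S. S \<in> ?\<A> \<Longrightarrow> infinite (S \<inter> D) \<and> infinite (S - D)"
    using splitting_set_exists[of ?\<A>] by blast
  have D1: "infinite (Y \<inter> B \<inter> D)" "infinite (Y \<inter> B - D)" if "B \<in> U" "infinite (Y \<inter> B)" for B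
    using D[of "Y \<inter> B"] that by auto
  have D2: "infinite ((Y - B) \<inter> D)" "infinite (Y - B - D)" if "B \<in> U" "infinite (Y - B)" for B
    using D[of "Y - B"] that by auto
  define C where "C = A \<union> (D \<inter> Y)"
  have "base_family (U \<union> finite_swaps C)"
  proof (rule base_family_add[OF _ U])
    fix B assume B: "B \<in> U"
    \<comment> \<open>If \<open>A - B\<close> is finite, then \<open>Y - B\<close> is infinite and
      \<open>D\<close> brings infinitely many of its points into \<open>C\<close>. For
      \<open>B - C\<close>, the points of \<open>Y \<inter> B\<close> outside \<open>D\<close> serve
      in the same way.\<close>
    have "X - B = (A - B) \<union> (Y - B)" using X Y_def by blast
    then have "infinite (A - B) \<or> infinite (Y - B)" using inf(1)[OF B] by (metis finite_Un)
    then have "infinite (A - B) \<or> infinite ((Y - B) \<inter> D)" using D2 B by blast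
    moreover have "A - B \<subseteq> C - B" "(Y - B) \<inter> D \<subseteq> C - B" unfolding C_def by auto
    ultimately show "infinite (C - B)" using finite_subset by blast
    have "B - A = (B - X) \<union> (Y \<inter> B)" using X Y_def by blast
    then have "infinite (B - X) \<or> infinite (Y \<inter> B)" using inf(2)[OF B] by (metis finite_Un)
    then have "infinite (B - X) \<or> infinite (Y \<inter> B - D)" using D1 B by blast
    moreover have "B - X \<subseteq> B - C" "Y \<inter> B - D \<subseteq> B - C" using X unfolding C_def Y_def by auto
    ultimately show "infinite (B - C)" using finite_subset by blast
  next
    show "- C \<notin> U"
    proof
      assume C: "- C \<in> U"
      \<comment> \<open>On \<open>Y\<close> the set \<open>- C\<close> agrees with
        \<open>- D\<close>, so \<open>D\<close> splits neither its trace nor the rest of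
        \<open>Y\<close>. Both are then finite although \<open>Y\<close> is infinite.\<close>
      have "Y \<inter> - C \<inter> D = {}" "Y - - C - D = {}" unfolding C_def Y_def by auto
      then have "finite (Y \<inter> - C)" "finite (Y - - C)" using D1(1)[OF C] D2(2)[OF C] by (metis finite.emptyI)+
      moreover have "Y = (Y \<inter> - C) \<union> (Y - - C)" by blast
      ultimately show False using X(2) Y_def by (metis finite_Un)
    qed
  qed simp
  moreover have "settles p (U \<union> finite_swaps C)"
  proof -
    have "A \<subseteq> C" "C \<subseteq> X" using X(1) unfolding C_def Y_def by auto
    then show ?thesis
      using finite_swaps_refl[of C] unfolding settles_def A_def[symmetric] X_def[symmetric] by blast
  qed
  moreover have "countable (U \<union> finite_swaps C)"
    using \<open>countable U\<close> countable_finite_swaps by simp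
  ultimately show ?thesis by (intro exI[of _ "U \<union> finite_swaps C"]) simp
qed

lemma settles_mono:
  assumes "settles p U" "U \<subseteq> V"
  shows "settles p V"
  unfolding settles_def
proof (intro impI)
  assume "fst p \<subseteq> snd p" "infinite (snd p - fst p)"
  with assms(1) obtain B where "B \<in> U" "snd p \<subseteq> B \<or> B \<subseteq> fst p \<or> (fst p \<subseteq> B \<and> B \<subseteq> snd p)"
    unfolding settles_def by blast
  with assms(2) show "\<exists>B\<in>V. snd p \<subseteq> B \<or> B \<subseteq> fst p \<or> (fst p \<subseteq> B \<and> B \<subseteq> snd p)" by blast
qed

section \<open>Transfinite construction along a well-order\<close>

text \<open>Each stage applies \<open>step\<close> to the union of the earlier stages, which is
  countable because initial segments are. The union of all stages may be uncountable;
  \<open>chain\<close> and \<open>mono\<close> carry goodness and the requirements over to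
  it.\<close>

lemma transfinite_closure:
  fixes r :: "'t rel" and good :: "'b set \<Rightarrow> bool" and Q :: "'t \<Rightarrow> 'b set \<Rightarrow> bool"
  assumes r: "well_order_on UNIV r" "\<And>t. countable (underS r t)"
    and init: "good U\<^sub>0" "countable U\<^sub>0"
    and step: "\<And>t U. good U \<Longrightarrow> countable U \<Longrightarrow> \<exists>V. U \<subseteq> V \<and> good V \<and> countable V \<and> Q t V"
    and chain: "\<And>\<C>. (\<And>U. U \<in> \<C> \<Longrightarrow> good U) \<Longrightarrow>
      (\<And>U V. U \<in> \<C> \<Longrightarrow> V \<in> \<C> \<Longrightarrow> U \<subseteq> V \<or> V \<subseteq> U) \<Longrightarrow> good (\<Union>\<C>)"
    and mono: "\<And>t U V. Q t U \<Longrightarrow> U \<subseteq> V \<Longrightarrow> Q t V"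
  shows "\<exists>U. U\<^sub>0 \<subseteq> U \<and> good U \<and> (\<forall>t. Q t U)"
proof -
  have wf: "wf (r - Id)" using r(1) by (simp add: well_order_on_def)
  have total: "s = t \<or> s \<in> underS r t \<or> t \<in> underS r s" for s t
    using r(1) unfolding well_order_on_def linear_order_on_def total_on_def underS_def by blast
  define S where "S t U = (SOME V. U \<subseteq> V \<and> good V \<and> countable V \<and> Q t V)" for t U
  have S: "U \<subseteq> S t U \<and> good (S t U) \<and> countable (S t U) \<and> Q t (S t U)"
    if "good U" "countable U" for t U
    unfolding S_def using step[OF that] by (rule someI_ex)
  \<comment> \<open>Inserting \<open>U\<^sub>0\<close> makes the union equal to
    \<open>U\<^sub>0\<close> at the least index.\<close>
  define F where "F = wfrec (r - Id) (\<lambda>f t. S t (\<Union> (insert U\<^sub>0 (f ` underS r t))))"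
  have F: "F t = S t (\<Union> (insert U\<^sub>0 (F ` underS r t)))" for t
  proof -
    have "cut F (r - Id) t ` underS r t = F ` underS r t"
      by (intro image_cong) (auto simp: cut_def underS_def)
    then show ?thesis
      unfolding F_def by (subst wfrec[OF wf]) simp
  qed
  \<comment> \<open>The last conjunct makes the stages a chain; inside the induction this is what
    gives a good union of the earlier stages.\<close>
  have main: "good (F t) \<and> countable (F t) \<and> U\<^sub>0 \<subseteq> F t \<and> Q t (F t) \<and> (\<forall>s\<in>underS r t. F s \<subseteq> F t)" for t
  proof (induction t rule: wf_induct_rule[OF wf])
    case (1 t)
    have IH: "good (F s)" "countable (F s)" "U\<^sub>0 \<subseteq> F s" "\<forall>u\<in>underS r s. F u \<subseteq> F s"
      if "s \<in> underS r t" for s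
      using 1[of s] that by (auto simp: underS_def)
    let ?W = "\<Union> (insert U\<^sub>0 (F ` underS r t))"
    have "good ?W"
    proof (rule chain)
      fix U V assume "U \<in> insert U\<^sub>0 (F ` underS r t)" "V \<in> insert U\<^sub>0 (F ` underS r t)"
      then show "U \<subseteq> V \<or> V \<subseteq> U"
        using IH(3,4) total by (smt (verit) imageE insertE order_refl)
    qed (use IH init in auto)
    moreover have "countable ?W"
      using IH(2) init(2) r(2)[of t] by auto
    ultimately show ?case
      using S[of ?W t] F[of t] by auto
  qed
  let ?U = "\<Union> (insert U\<^sub>0 (range F))"
  have "good ?U"
  proof (rule chain)
    fix U V assume "U \<in> insert U\<^sub>0 (range F)" "V \<in> insert U\<^sub>0 (range F)"
    then show "U \<subseteq> V \<or> V \<subseteq> U"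
      using main total by (smt (verit) imageE insertE order_refl)
  qed (use main init in auto)
  moreover have "Q t ?U" for t
  proof (rule mono)
    show "Q t (F t)" using main by simp
    show "F t \<subseteq> ?U" by blast
  qed
  ultimately show ?thesis by (intro exI[of _ ?U]) simp
qed

section \<open>Countable initial segments from the Continuum Hypothesis\<close>

text \<open>A pair is coded in one set of naturals by its even and its odd members, and such sets
  are equipollent to the reals, the type \<open>CH\<close> is stated for.\<close>

lemma inj_nat_set_pair_real: "\<exists>f :: nat set \<times> nat set \<Rightarrow> real. inj f"
proof -
  define c :: "nat set \<times> nat set \<Rightarrow> nat set"
    where "c = (\<lambda>(A, X). (\<lambda>n. 2 * n) ` A \<union> (\<lambda>n. Suc (2 * n)) ` X)"
  have "2 * n \<noteq> Suc (2 * m)" "Suc (2 * m) \<noteq> 2 * n" for m n :: nat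
    by presburger+
  then have "2 * n \<in> c (A, X) \<longleftrightarrow> n \<in> A" "Suc (2 * n) \<in> c (A, X) \<longleftrightarrow> n \<in> X" for A X n
    unfolding c_def by (auto simp: image_iff)
  then have "(\<lambda>Z. ({n. 2 * n \<in> Z}, {n. Suc (2 * n) \<in> Z})) (c p) = p" for p
    by (cases p) simp
  then have "inj c"
    by (rule inj_on_inverseI)
  moreover obtain f :: "nat set \<Rightarrow> real" where "inj f"
    using eqpoll_imp_lepoll[OF nat_sets_eqpoll_reals] unfolding lepoll_def by auto
  ultimately have "inj (f \<circ> c)"
    by (intro inj_compose)
  then show ?thesis by blast
qed

text \<open>In a cardinal well-order every proper segment is strictly smaller than the type. By
  \<open>CH\<close> an uncountable segment would have the size of the reals, into which the whole
  type embeds.\<close>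

lemma CH_countable_segments:
  assumes "CH" "\<exists>f :: 't \<Rightarrow> real. inj f"
  shows "\<exists>r :: 't rel. well_order_on UNIV r \<and> (\<forall>t. countable (underS r t))"
  including cardinal_syntax
proof (intro exI conjI allI)
  obtain f :: "'t \<Rightarrow> real" where f: "inj f" using assms by blast
  let ?r = "|UNIV :: 't set|"
  show "well_order_on UNIV ?r" by (rule card_of_well_order_on)
  fix t
  have less: "|underS ?r t| <o ?r"
    by (rule card_of_underS[OF card_of_Card_order]) (simp add: Field_card_of)
  show "countable (underS ?r t)"
  proof (rule ccontr)
    assume "uncountable (underS ?r t)"
    then have "uncountable (f ` underS ?r t)"
      using f by (metis countable_image_inj_on inj_on_subset subset_UNIV)
    then have "f ` underS ?r t \<approx> (UNIV :: real set)"
      using assms(1) by (auto simp: CH_def)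
    then obtain g where "bij_betw g (UNIV :: real set) (f ` underS ?r t)"
      using eqpoll_sym eqpoll_def by blast
    then have "|UNIV :: real set| \<le>o |f ` underS ?r t|"
      by (metis bij_betw_def card_of_ordLeq order_refl)
    moreover have "|UNIV :: 't set| \<le>o |UNIV :: real set|"
      by (rule card_of_ordLeqI[OF f]) simp
    ultimately have "|UNIV :: 't set| \<le>o |underS ?r t|"
      by (meson card_of_image ordLeq_transitive)
    with less show False by (simp add: not_ordLess_ordLeq)
  qed
qed

section \<open>From base families to matroids\<close>

lemma uniform_matroid:
  assumes U: "base_family U" "U \<noteq> {}" and settles: "\<And>p. settles p U"
  shows "matroid UNIV {I. \<exists>B\<in>U. I \<subseteq> B}" "base {I. \<exists>B\<in>U. I \<subseteq> B} B \<longleftrightarrow> B \<in> U"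
proof -
  let ?I = "{I. \<exists>B\<in>U. I \<subseteq> B}"
  have max: "maximal_in ?I B \<longleftrightarrow> B \<in> U" for B
    unfolding maximal_in_def using base_family_antichain[OF U(1)] by blast
  then show "base ?I B \<longleftrightarrow> B \<in> U" by (simp add: base_def)
  have exch: "\<exists>x\<in>B - I. insert x I \<in> ?I" if I: "I \<in> ?I" "I \<notin> U" and B: "B \<in> U" for I B
  proof -
    obtain B' where "B' \<in> U" "I \<subseteq> B'" using I(1) by blast
    moreover from this I(2) have "B' - I \<noteq> {}" by auto
    ultimately obtain z where B': "B' \<in> U" "I \<subseteq> B'" "z \<in> B' - I" by blast
    have "\<not> B \<subseteq> I"
      using base_family_antichain[OF U(1) B B'(1)] B' by blast
    \<comment> \<open>Any such \<open>x\<close> will do: if it lies outside \<open>B'\<close>, it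
      takes the place of \<open>z\<close>, which is not in \<open>I\<close>.\<close>
    then obtain x where x: "x \<in> B - I" by blast
    have "insert x I \<in> ?I"
    proof (cases "x \<in> B'")
      case False
      then have "insert x (B' - {z}) \<in> U" using base_family_swap[OF U(1) B'(1), of z x] B'(3) by simp
      moreover have "insert x I \<subseteq> insert x (B' - {z})" using B' by blast
      ultimately show ?thesis by blast
    next
      case True
      then have "insert x I \<subseteq> B'" using B' by blast
      then show ?thesis using B'(1) by blast
    qed
    then show ?thesis using x by (rule rev_bexI[rotated])
  qed
  have ext: "\<exists>B. A \<subseteq> B \<and> maximal_in (?I \<inter> Pow X) B" if A: "A \<in> ?I" "A \<subseteq> X" for A X
  proof (cases "finite (X - A)")
    case True
    let ?S = "{B \<in> ?I \<inter> Pow X. A \<subseteq> B}"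
    have "?S \<subseteq> (\<lambda>Z. A \<union> Z) ` Pow (X - A)"
    proof
      fix B assume "B \<in> ?S"
      then have "B = A \<union> (B - A)" "B - A \<in> Pow (X - A)" by auto
      then show "B \<in> (\<lambda>Z. A \<union> Z) ` Pow (X - A)" by blast
    qed
    then have "finite ?S" using True by (simp add: finite_subset)
    moreover have "A \<in> ?S" using A by simp
    ultimately have "\<exists>B\<in>?S. A \<subseteq> B \<and> (\<forall>C\<in>?S. B \<subseteq> C \<longrightarrow> B = C)"
      by (rule finite_has_maximal2)
    then obtain B where B: "B \<in> ?S" "\<forall>C\<in>?S. B \<subseteq> C \<longrightarrow> B = C"
      by (elim bexE conjE) (rule that)
    have "maximal_in (?I \<inter> Pow X) B"
      unfolding maximal_in_def
    proof (intro conjI ballI impI)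
      show "B \<in> ?I \<inter> Pow X" using B(1) by simp
      fix C assume "C \<in> ?I \<inter> Pow X" "B \<subseteq> C"
      then show "C = B" using B(1) bspec[OF B(2), of C] by auto
    qed
    then show ?thesis using B(1) by blast
  next
    case False
    \<comment> \<open>In the first case \<open>X\<close> is independent and itself the maximal set,
      in the second \<open>A\<close> is a base, and in the third the base between them is
      maximal.\<close>
    then obtain B where B: "B \<in> U" "X \<subseteq> B \<or> B \<subseteq> A \<or> (A \<subseteq> B \<and> B \<subseteq> X)"
      using settles[of "(A, X)"] A(2) unfolding settles_def by auto
    have A': "B = A" if BA: "B \<subseteq> A"
    proof -
      obtain B' where "B' \<in> U" "A \<subseteq> B'" using A(1) by blast
      then show ?thesis using base_family_antichain[OF U(1) B(1), of B'] BA by blast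
    qed
    show ?thesis
    proof (cases "X \<subseteq> B")
      case True
      then have "maximal_in (?I \<inter> Pow X) X" using B(1) unfolding maximal_in_def by blast
      then show ?thesis using A(2) by blast
    next
      case False
      then have "A \<subseteq> B" "B \<subseteq> X" using A' A(2) B(2) by auto
      moreover from \<open>B \<subseteq> X\<close> have "maximal_in (?I \<inter> Pow X) B"
        using max[of B] B(1) unfolding maximal_in_def by auto
      ultimately show ?thesis by blast
    qed
  qed
  show "matroid UNIV ?I"
    unfolding matroid_def max
  proof (intro conjI ballI allI impI)
    fix I B assume "I \<in> ?I" "B \<in> U \<and> I \<notin> U"
    then show "\<exists>x\<in>B - I. insert x I \<in> ?I" using exch[of I B] by simp
  next
    fix I J assume "I \<in> ?I" "J \<subseteq> I"
    then obtain B' where "B' \<in> U" "J \<subseteq> B'" by blast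
    then show "J \<in> ?I" by blast
  next
    fix X A assume "A \<in> ?I" "A \<subseteq> X"
    then show "\<exists>B. A \<subseteq> B \<and> maximal_in (?I \<inter> Pow X) B" by (rule ext)
  qed (use U(2) in auto)
qed

section \<open>The initial family\<close>

text \<open>This reduces incomparability with a whole exchange class to infinite differences with
  its representative \<open>R\<close>.\<close>

lemma finite_Diff_finite_swaps:
  assumes "B \<in> finite_swaps R"
  shows "finite (C - B) \<Longrightarrow> finite (C - R)" "finite (B - C) \<Longrightarrow> finite (R - C)"
proof -
  have "C - R \<subseteq> (C - B) \<union> (B - R)" "R - C \<subseteq> (B - C) \<union> (R - B)"
    by auto
  moreover have "finite (B - R)" "finite (R - B)"
    using assms by (auto simp: finite_swaps_def)
  ultimately show "finite (C - B) \<Longrightarrow> finite (C - R)" "finite (B - C) \<Longrightarrow> finite (R - C)"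
    using finite_subset finite_Un by metis+
qed

text \<open>The bound \<open>l < n\<close> tolerates exceptional small numbers, such as the points 0
  and 1 in the initial family.\<close>

lemma infinite_residue_class:
  fixes k l :: nat
  assumes "k < l" "\<And>n. n mod l = k \<Longrightarrow> l < n \<Longrightarrow> n \<in> S"
  shows "infinite S"
proof -
  \<comment> \<open>The shift by 2 keeps the values strictly above \<open>l\<close> even for
    \<open>k = 0\<close>.\<close>
  have "inj (\<lambda>m. l * (m + 2) + k)" using assms(1) by (intro injI) simp
  moreover have "l * (m + 2) + k \<in> S" for m
  proof (rule assms(2))
    show "(l * (m + 2) + k) mod l = k" using assms(1) by (simp only: mod_mult_self4 mod_less)
    show "l < l * (m + 2) + k" using assms(1) by (simp add: distrib_left)
  qed
  then have "range (\<lambda>m. l * (m + 2) + k) \<subseteq> S" by blast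
  ultimately show ?thesis by (blast dest: range_inj_infinite infinite_super)
qed

text \<open>\<open>P\<^sub>1\<close>, \<open>P\<^sub>2\<close> are the packing and
  \<open>Q\<^sub>1\<close>, \<open>Q\<^sub>2\<close> the covering. The two pairs halve the residues
  modulo 4 in crossing ways, so each \<open>P\<close> differs infinitely from each \<open>Q\<close>
  and from its complement.\<close>

lemma base_family_init:
  "\<exists>U :: nat set set. base_family U \<and> countable U \<and>
     (\<exists>B\<in>U. \<exists>C\<in>U. B \<inter> C = {}) \<and> (\<exists>B\<in>U. \<exists>C\<in>U. B \<union> C = UNIV)"
proof -
  define P\<^sub>1 P\<^sub>2 Q\<^sub>1 Q\<^sub>2 :: "nat set"
    where P1: "P\<^sub>1 = {n. n mod 4 \<in> {0, 2}}" and P2: "P\<^sub>2 = {n. n mod 4 \<in> {1, 3}} - {1}"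
      and Q1: "Q\<^sub>1 = {n. n mod 4 \<in> {0, 1}}" and Q2: "Q\<^sub>2 = {n. n mod 4 \<in> {2, 3}} \<union> {0}"
  note defs = P1 P2 Q1 Q2
  note inf_diff = infinite_residue_class[of 0 4] infinite_residue_class[of 1 4]
    infinite_residue_class[of 2 4] infinite_residue_class[of 3 4]
  have inf: "infinite (UNIV :: nat set)" by simp
  \<comment> \<open>The points 1 and 0 make \<open>- P\<^sub>2\<close> and \<open>- Q\<^sub>2\<close> strictly comparable with \<open>P\<^sub>1\<close> and \<open>Q\<^sub>1\<close>.\<close>
  have ne: "- P\<^sub>2 \<notin> finite_swaps P\<^sub>1" "- Q\<^sub>2 \<notin> finite_swaps Q\<^sub>1"
  proof -
    have "P\<^sub>1 \<subseteq> - P\<^sub>2" "1 \<in> - P\<^sub>2 - P\<^sub>1" "- Q\<^sub>2 \<subseteq> Q\<^sub>1" "0 \<in> Q\<^sub>1 - - Q\<^sub>2"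
      unfolding defs by auto
    then show "- P\<^sub>2 \<notin> finite_swaps P\<^sub>1" "- Q\<^sub>2 \<notin> finite_swaps Q\<^sub>1"
      using finite_swaps_antichain finite_swaps_refl by (metis DiffD1 DiffD2)+
  qed
  have infs: "infinite (P\<^sub>2 - P\<^sub>1)" "infinite (P\<^sub>1 - P\<^sub>2)" "infinite (Q\<^sub>2 - Q\<^sub>1)" "infinite (Q\<^sub>1 - Q\<^sub>2)"
    "infinite (Q\<^sub>1 - P\<^sub>1)" "infinite (P\<^sub>1 - Q\<^sub>1)" "infinite (Q\<^sub>1 - P\<^sub>2)" "infinite (P\<^sub>2 - Q\<^sub>1)"
    "infinite (Q\<^sub>2 - P\<^sub>1)" "infinite (P\<^sub>1 - Q\<^sub>2)" "infinite (Q\<^sub>2 - P\<^sub>2)" "infinite (P\<^sub>2 - Q\<^sub>2)"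
    and infs_compl: "infinite (- Q\<^sub>1 - P\<^sub>1)" "infinite (- Q\<^sub>1 - P\<^sub>2)" "infinite (- Q\<^sub>2 - P\<^sub>1)"
    "infinite (- Q\<^sub>2 - P\<^sub>2)"
    \<comment> \<open>Each difference contains one residue class modulo 4 beyond 4; backtracking
      over the four classes finds it.\<close>
    by (rule inf_diff, simp, (simp add: defs; fail))+
  have compl_ne: "- C \<notin> finite_swaps R" if "infinite (- C - R)" for C R :: "nat set"
    using that by (auto simp: finite_swaps_def)
  \<comment> \<open>The classes are adjoined one by one. A complement avoids the class of the
    partner by \<open>ne\<close> and those of the other pair by \<open>compl_ne\<close>.\<close>
  have "base_family ({} :: nat set set)"
    by (simp add: base_family_def)
  then have "base_family ({} \<union> finite_swaps P\<^sub>1)"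
    by (rule base_family_add[OF inf]) auto
  then have "base_family ({} \<union> finite_swaps P\<^sub>1 \<union> finite_swaps P\<^sub>2)"
    by (rule base_family_add[OF inf]) (use infs ne in \<open>auto dest: finite_Diff_finite_swaps\<close>)
  then have "base_family ({} \<union> finite_swaps P\<^sub>1 \<union> finite_swaps P\<^sub>2 \<union> finite_swaps Q\<^sub>1)"
    by (rule base_family_add[OF inf])
      (use infs compl_ne[OF infs_compl(1)] compl_ne[OF infs_compl(2)] in \<open>auto dest: finite_Diff_finite_swaps\<close>)
  then have "base_family ({} \<union> finite_swaps P\<^sub>1 \<union> finite_swaps P\<^sub>2 \<union> finite_swaps Q\<^sub>1 \<union> finite_swaps Q\<^sub>2)"
    (is "base_family ?U")
    by (rule base_family_add[OF inf])
      (use infs ne compl_ne[OF infs_compl(3)] compl_ne[OF infs_compl(4)] in \<open>auto dest: finite_Diff_finite_swaps\<close>)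
  moreover have "countable ?U"
    by (simp add: countable_finite_swaps)
  moreover have "P\<^sub>1 \<in> ?U" "P\<^sub>2 \<in> ?U" "Q\<^sub>1 \<in> ?U" "Q\<^sub>2 \<in> ?U"
    by (simp_all add: finite_swaps_refl)
  moreover have "P\<^sub>1 \<inter> P\<^sub>2 = {}" "Q\<^sub>1 \<union> Q\<^sub>2 = UNIV"
    unfolding defs by auto
  ultimately show ?thesis
    by (intro exI[of _ ?U] conjI) (assumption | rule bexI)+
qed

theorem theorem1p5:
  assumes "CH"
  shows "\<exists>(E :: nat set) Ind. matroid E Ind \<and>
           has_base_packing2 E Ind \<and> has_base_covering2 E Ind \<and>
           \<not> has_base_partitioning2 E Ind"
proof -
  obtain r :: "(nat set \<times> nat set) rel"
    where r: "well_order_on UNIV r" "\<And>t. countable (underS r t)"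
    using CH_countable_segments[OF assms inj_nat_set_pair_real] by blast
  obtain U\<^sub>0 :: "nat set set" where U0: "base_family U\<^sub>0" "countable U\<^sub>0"
    "\<exists>B\<in>U\<^sub>0. \<exists>C\<in>U\<^sub>0. B \<inter> C = {}" "\<exists>B\<in>U\<^sub>0. \<exists>C\<in>U\<^sub>0. B \<union> C = UNIV"
    using base_family_init by blast
  \<comment> \<open>The indices are the pairs \<open>p\<close>, goodness is
    \<open>base_family\<close>, and the requirement at index \<open>p\<close> is
    \<open>settles p\<close>.\<close>
  have "\<exists>U. U\<^sub>0 \<subseteq> U \<and> base_family U \<and> (\<forall>p. settles p U)"
    using r U0(1,2) base_family_extend base_family_Union_chain settles_mono
    by (rule transfinite_closure)
  then obtain U where U: "U\<^sub>0 \<subseteq> U" "base_family U" "\<And>p. settles p U" by blast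
  have "U \<noteq> {}" using U(1) U0(3) by blast
  note M = uniform_matroid[OF U(2) this U(3)]
  have "- B \<notin> U" if "B \<in> U" for B
    using base_family_compl U(2) that by blast
  moreover have "C = - B" if "B \<inter> C = {}" "B \<union> C = UNIV" for B C :: "nat set"
    using that by blast
  ultimately have "\<not> has_base_partitioning2 UNIV {I. \<exists>B\<in>U. I \<subseteq> B}"
    unfolding has_base_partitioning2_def M(2) by blast
  moreover have "has_base_packing2 UNIV {I. \<exists>B\<in>U. I \<subseteq> B}"
    unfolding has_base_packing2_def M(2) using U0(3) U(1) by blast
  moreover have "has_base_covering2 UNIV {I. \<exists>B\<in>U. I \<subseteq> B}"
    unfolding has_base_covering2_def M(2) using U0(4) U(1) by blast
  ultimately show ?thesis using M(1) by (intro exI conjI)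
qed

end
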